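(* Let $\beta>0$ and $f(t)=t^\beta$. Let $i,j$ be two jobs with $p_i\le p_j$. If $i\prec_\ell j$, then $i\prec_g j$.
   Context: Fix a constant $\beta>0$ and let $f(t)=t^\beta$ for $t\ge 0$. A job $k$ has a processing time $p_k>0$ and a weight $w_k>0$. An instance is a finite set of jobs; a schedule is an ordering (sequence) of all jobs of the instance, processed consecutively without idle time from time $0$ on a single machine; the completion time $C_k$ of job $k$ is the sum of the processing times of $k$ and of all jobs preceding it; the cost of a schedule $S$ is $F(S)=\sum_k w_k f(C_k)$, and a schedule is optimal if it minimizes $F$. Standing assumption: within an instance no two jobs have the same processing time, the same weight, or the same ratio $w_k/p_k$. Local order: $i\prec_\ell j$ means that for every $t\ge 0$, $w_j\big(f(t+p_i+p_j)-f(t+p_j)\big) < w_i\big(f(t+p_i+p_j)-f(t+p_i)\big)$ (i.e. whenever $i$ and $j$ are adjacent and start at time $t$, ordering $i$ before $j$ is strictly cheaper than $j$ before $i$). Global order: $i\prec_g j$ means that for every instance containing $i$ and $j$ (together with arbitrary other jobs), every optimal schedule processes $i$ before $j$. *)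

theory Defs
  imports Complex_Main
begin

text \<open>
  Distinct jobs of an instance have distinct processing times, so a job can be identified with its
  pair of parameters, and an instance is a finite set of such pairs.
\<close>

datatype job = Job (proc: real) (weight: real)

definition valid_job :: "job \<Rightarrow> bool" where
  "valid_job k \<longleftrightarrow> proc k > 0 \<and> weight k > 0"

definition is_instance :: "job set \<Rightarrow> bool" where
  "is_instance J \<longleftrightarrow> finite J \<and> (\<forall>k\<in>J. valid_job k) \<and>
     inj_on proc J \<and> inj_on weight J \<and> inj_on (\<lambda>k. weight k / proc k) J"

definition is_schedule :: "job set \<Rightarrow> job list \<Rightarrow> bool" where
  "is_schedule J S \<longleftrightarrow> distinct S \<and> set S = J"

definition processed_before :: "job list \<Rightarrow> job \<Rightarrow> job \<Rightarrow> bool" where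
  "processed_before S i j \<longleftrightarrow> (\<exists>a b. a < b \<and> b < length S \<and> S ! a = i \<and> S ! b = j)"

definition completion_time :: "job list \<Rightarrow> job \<Rightarrow> real" where
  "completion_time S k = (\<Sum>l\<in>{l \<in> set S. l = k \<or> processed_before S l k}. proc l)"

definition cost :: "(real \<Rightarrow> real) \<Rightarrow> job list \<Rightarrow> real" where
  "cost f S = (\<Sum>k\<in>set S. weight k * f (completion_time S k))"

definition is_optimal :: "(real \<Rightarrow> real) \<Rightarrow> job set \<Rightarrow> job list \<Rightarrow> bool" where
  "is_optimal f J S \<longleftrightarrow> is_schedule J S \<and> (\<forall>S'. is_schedule J S' \<longrightarrow> cost f S \<le> cost f S')"

definition local_order :: "(real \<Rightarrow> real) \<Rightarrow> job \<Rightarrow> job \<Rightarrow> bool" where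
  "local_order f i j \<longleftrightarrow> (\<forall>t\<ge>0.
     weight j * (f (t + proc i + proc j) - f (t + proc j))
       < weight i * (f (t + proc i + proc j) - f (t + proc i)))"

definition global_order :: "(real \<Rightarrow> real) \<Rightarrow> job \<Rightarrow> job \<Rightarrow> bool" where
  "global_order f i j \<longleftrightarrow> (\<forall>J. is_instance J \<and> i \<in> J \<and> j \<in> J \<longrightarrow>
     (\<forall>S. is_optimal f J S \<longrightarrow> processed_before S i j))"

end

theory Submission
  imports Defs
begin

text \<open>
  The argument works for every strictly increasing \<open>f\<close>. Suppose an optimal schedule has the form
  \<open>A j B i D\<close>, with \<open>j\<close> starting at time \<open>t\<close>, and compare it with \<open>A i j B D\<close> and with \<open>A i B j D\<close>.
  If \<open>w\<^sub>i \<ge> w\<^sub>j\<close>, then \<open>A i B j D\<close> is cheaper. Otherwise, weight the improvements achieved by the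
  two alternatives by \<open>w\<^sub>j - w\<^sub>i\<close> and \<open>w\<^sub>i\<close>, respectively. The local order at time \<open>x - p\<^sub>j\<close> reads
  \<open>(w\<^sub>j - w\<^sub>i) (f (x + p\<^sub>i) - f x) < w\<^sub>i (f x - f (x - (p\<^sub>j - p\<^sub>i)))\<close>. For \<open>x\<close> the completion time of a
  job of \<open>B\<close> this shows that the contribution of \<open>B\<close> to the weighted sum is nonnegative, and for
  \<open>x = t + p\<^sub>j\<close> that the contribution of \<open>i\<close> and \<open>j\<close> is positive. Hence one of the alternatives is
  strictly cheaper.
\<close>

text \<open>The start time \<open>t\<close> is a parameter so that costs split along concatenation
  and a block can be compared with its shifted copies.\<close>

fun cost_from :: "(real \<Rightarrow> real) \<Rightarrow> real \<Rightarrow> job list \<Rightarrow> real" where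
  "cost_from f t [] = 0"
| "cost_from f t (k # ks) = weight k * f (t + proc k) + cost_from f (t + proc k) ks"

abbreviation total_proc :: "job list \<Rightarrow> real" where
  "total_proc ks \<equiv> sum_list (map proc ks)"

lemma cost_from_append:
  "cost_from f t (xs @ ys) = cost_from f t xs + cost_from f (t + total_proc xs) ys"
  by (induction xs arbitrary: t) (auto simp: algebra_simps)

lemma processed_before_iff_prefix:
  assumes "distinct (A @ k # B)"
  shows "processed_before (A @ k # B) l k \<longleftrightarrow> l \<in> set A"
proof
  assume "processed_before (A @ k # B) l k"
  then obtain a b where ab: "a < b" "b < length (A @ k # B)"
    "(A @ k # B) ! a = l" "(A @ k # B) ! b = k"
    unfolding processed_before_def by blast
  have "b = length A"
    using nth_eq_iff_index_eq[OF assms ab(2), of "length A"] ab(4) by simp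
  with ab show "l \<in> set A" by (auto simp: nth_append)
next
  assume "l \<in> set A"
  then obtain a where "a < length A" "A ! a = l" by (auto simp: in_set_conv_nth)
  then show "processed_before (A @ k # B) l k"
    unfolding processed_before_def
    by (intro exI[of _ a] exI[of _ "length A"]) (auto simp: nth_append)
qed

lemma completion_time_append_Cons:
  assumes "distinct (A @ k # B)"
  shows "completion_time (A @ k # B) k = total_proc A + proc k"
proof -
  have "{l \<in> set (A @ k # B). l = k \<or> processed_before (A @ k # B) l k} = insert k (set A)"
    using processed_before_iff_prefix[OF assms] by auto
  then show ?thesis
    using assms by (simp add: completion_time_def sum_list_distinct_conv_sum_set)
qed

text \<open>The fixed prefix \<open>A\<close> is what lets the induction pass: the head of
  \<open>B\<close> moves to the end of \<open>A\<close>.\<close>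

lemma sum_weight_completion_time_suffix:
  assumes "distinct (A @ B)"
  shows "(\<Sum>k\<in>set B. weight k * f (completion_time (A @ B) k)) = cost_from f (total_proc A) B"
  using assms
proof (induction B arbitrary: A)
  case (Cons k B)
  then show ?case
    using Cons.IH[of "A @ [k]"] completion_time_append_Cons[of A k B] by simp
qed simp

lemma cost_eq_cost_from:
  assumes "distinct S"
  shows "cost f S = cost_from f 0 S"
  using sum_weight_completion_time_suffix[of "[]" S f] assms by (simp add: cost_def)

text \<open>Apply the first assumption with \<open>x\<close> the completion time of each job of
  \<open>B\<close> started at \<open>s\<close>, multiply by its weight and add up. All these times
  are at least \<open>s\<close>.\<close>

lemma cost_from_shift_le:
  assumes "\<And>x. x \<ge> s \<Longrightarrow> v * (f (x + a) - f x) \<le> u * (f x - f (x - q))"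
    and "\<And>k. k \<in> set B \<Longrightarrow> proc k \<ge> 0 \<and> weight k \<ge> 0"
  shows "v * (cost_from f (s + a) B - cost_from f s B)
    \<le> u * (cost_from f s B - cost_from f (s - q) B)"
  using assms
proof (induction B arbitrary: s)
  case (Cons k B)
  have k: "proc k \<ge> 0" "weight k \<ge> 0" using Cons.prems(2) by auto
  have "v * (cost_from f (s + proc k + a) B - cost_from f (s + proc k) B)
    \<le> u * (cost_from f (s + proc k) B - cost_from f (s + proc k - q) B)"
  proof (rule Cons.IH)
    show "v * (f (x + a) - f x) \<le> u * (f x - f (x - q))" if "x \<ge> s + proc k" for x
      using Cons.prems(1)[of x] that k by linarith
  qed (use Cons.prems(2) in auto)
  moreover have "weight k * (v * (f (s + proc k + a) - f (s + proc k)))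
    \<le> weight k * (u * (f (s + proc k) - f (s + proc k - q)))"
    using Cons.prems(1) k by (intro mult_left_mono) auto
  ultimately show ?case by (simp add: algebra_simps)
qed simp

lemma is_schedule_split:
  assumes "is_schedule J S" "i \<in> J" "j \<in> J" "i \<noteq> j" "\<not> processed_before S i j"
  obtains A B D where "S = A @ j # B @ i # D"
proof -
  from assms obtain A E where S: "S = A @ j # E"
    unfolding is_schedule_def by (meson split_list)
  with assms have "i \<notin> set A" "i \<in> set E"
    using processed_before_iff_prefix[of A j E i] by (auto simp: is_schedule_def)
  then obtain B D where "E = B @ i # D" by (meson split_list)
  with S that show thesis by blast
qed

theorem local_order_imp_global_order:
  assumes mono: "strict_mono_on {0..} f"
    and "valid_job i" and "valid_job j"
    and "proc i \<le> proc j"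
    and loc: "local_order f i j"
  shows "global_order f i j"
  unfolding global_order_def
proof (intro allI impI, elim conjE)
  fix J S
  assume inst: "is_instance J" and iJ: "i \<in> J" and jJ: "j \<in> J" and opt: "is_optimal f J S"
  have sched: "is_schedule J S" using opt by (simp add: is_optimal_def)
  have ne: "i \<noteq> j" using loc by (auto simp: local_order_def)
  then have lt: "proc i < proc j"
    using inst iJ jJ assms(4) by (auto simp: is_instance_def inj_on_def order_less_le)
  have pos: "proc i > 0" "weight i > 0" "weight j > 0"
    using assms by (auto simp: valid_job_def)
  show "processed_before S i j"
  proof (rule ccontr)
    assume "\<not> processed_before S i j"
    with sched iJ jJ ne obtain A B D where S: "S = A @ j # B @ i # D"
      by (rule is_schedule_split)
    have valid: "\<And>k. k \<in> set S \<Longrightarrow> proc k > 0 \<and> weight k > 0"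
      using sched inst by (auto simp: is_schedule_def is_instance_def valid_job_def)
    define t where "t = total_proc A"
    define T where "T = t + proc j + total_proc B + proc i"
    \<comment> \<open>Truncation at 0 merges the two cases: if
      \<open>weight i \<ge> weight j\<close>, then \<open>v = 0\<close> and only the exchange of
      \<open>i\<close> and \<open>j\<close> counts.\<close>
    define u v where "u = weight i" and "v = max 0 (weight j - weight i)"
    have t: "t \<ge> 0" unfolding t_def using valid S by (intro sum_list_nonneg) force
    have B: "total_proc B \<ge> 0" using valid S by (intro sum_list_nonneg) force
    have f_less: "f x < f y" if "0 \<le> x" "x < y" for x y
      using strict_mono_onD[OF mono, of x y] that by simp
    have key: "v * (f (x + proc i) - f x) < u * (f x - f (x - (proc j - proc i)))"
      if x: "x \<ge> t + proc j" for x
    proof (cases "weight i < weight j")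
      case True
      have "weight j * (f (x - proc j + proc i + proc j) - f (x - proc j + proc j))
        < weight i * (f (x - proc j + proc i + proc j) - f (x - proc j + proc i))"
        using loc[unfolded local_order_def, rule_format, of "x - proc j"] x t by simp
      then show ?thesis using True by (simp add: u_def v_def algebra_simps)
    next
      case False
      have "f (x - (proc j - proc i)) < f x" using x t pos lt by (intro f_less) auto
      then show ?thesis using False pos by (simp add: u_def v_def)
    qed
    have block: "v * (cost_from f (t + proc j + proc i) B - cost_from f (t + proc j) B)
      \<le> u * (cost_from f (t + proc j) B - cost_from f (t + proc i) B)"
      using cost_from_shift_le[of "t + proc j" v f "proc i" u "proc j - proc i" B]
        key valid S by (force simp: less_imp_le)
    have le: "cost_from f 0 S \<le> cost_from f 0 S'" if "distinct S'" "set S' = set S" for S'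
    proof -
      have "is_schedule J S'" using that sched by (simp add: is_schedule_def)
      then have "cost f S \<le> cost f S'" using opt by (simp add: is_optimal_def)
      then show ?thesis using that sched by (simp add: cost_eq_cost_from is_schedule_def)
    qed
    have "cost_from f 0 S \<le> cost_from f 0 (A @ i # j # B @ D)"
      by (rule le) (use sched in \<open>auto simp: S is_schedule_def\<close>)
    \<comment> \<open>\<open>A\<close> and \<open>D\<close> cancel, since \<open>D\<close> starts at
      \<open>T\<close> in both sequences.\<close>
    then have move1: "weight i * (f T - f (t + proc i))
        - weight j * (f (t + proc i + proc j) - f (t + proc j))
      \<le> cost_from f (t + proc j + proc i) B - cost_from f (t + proc j) B" (is "?m1 \<le> _")
      by (simp add: S cost_from_append T_def t_def[symmetric] algebra_simps)
    have "cost_from f 0 S \<le> cost_from f 0 (A @ i # B @ j # D)"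
      by (rule le) (use sched in \<open>auto simp: S is_schedule_def\<close>)
    then have move2: "weight i * (f T - f (t + proc i)) - weight j * (f T - f (t + proc j))
      \<le> - (cost_from f (t + proc j) B - cost_from f (t + proc i) B)" (is "?m2 \<le> _")
      by (simp add: S cost_from_append T_def t_def[symmetric] algebra_simps)
    have "v * ?m1 + u * ?m2 \<le> 0"
      using mult_left_mono[OF move1, of v] mult_left_mono[OF move2, of u] block pos
      by (simp add: u_def v_def algebra_simps)
    moreover have "v * ?m1 + u * ?m2 > 0"
    proof (cases "weight i < weight j")
      case True
      \<comment> \<open>The terms in \<open>f T\<close> cancel because
        \<open>v * weight i = u * (weight j - weight i)\<close>.\<close>
      have "v * ?m1 + u * ?m2 = weight j * (u * (f (t + proc j) - f (t + proc i))
          - v * (f (t + proc j + proc i) - f (t + proc j)))"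
        using True by (simp add: u_def v_def algebra_simps)
      also have "\<dots> > 0" using key[of "t + proc j"] pos by simp
      finally show ?thesis .
    next
      case False
      have "f (t + proc j) < f T" "f (t + proc i) < f (t + proc j)"
        unfolding T_def using t B pos lt by (auto intro!: f_less)
      \<comment> \<open>This is \<open>?m2\<close> with \<open>weight i * f (t + proc j)\<close>
        subtracted and added.\<close>
      then have "(weight i - weight j) * (f T - f (t + proc j))
          + weight i * (f (t + proc j) - f (t + proc i)) > 0"
        using False pos by (intro add_nonneg_pos mult_pos_pos mult_nonneg_nonneg) auto
      then have "?m2 > 0" by (simp add: algebra_simps)
      then show ?thesis using False pos by (simp add: u_def v_def)
    qed
    ultimately show False by simp
  qed
qed

theorem theorem1:
  fixes \<beta> :: real and i j :: job
  assumes "\<beta> > 0"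
    and "valid_job i" and "valid_job j"
    and "proc i \<le> proc j"
    and "local_order (\<lambda>t. t powr \<beta>) i j"
  shows "global_order (\<lambda>t. t powr \<beta>) i j"
proof (rule local_order_imp_global_order[OF _ assms(2-)])
  show "strict_mono_on {0..} (\<lambda>t. t powr \<beta>)"
    using assms(1) by (auto intro!: strict_mono_onI powr_less_mono2)
qed

end
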